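(* Let $I$ be a right ideal in $\mathbb{H}[q_1,\ldots,q_n]$. Then the right ideal $\mathcal{J}(\mathcal{V}_c(I))$, generated by the slice regular polynomials vanishing on $\mathcal{V}_c(I)$, is contained in the set of slice regular polynomials vanishing on $\mathcal{V}(I)$.
   Context: $\mathbb{H}$ is the skew field of quaternions. A slice regular polynomial in $n$ variables is a function $P:\mathbb{H}^n\to\mathbb{H}$ of the form $P(q_1,\ldots,q_n)=\sum_{\ell} q_1^{\ell_1}\cdots q_n^{\ell_n}a_{\ell_1,\ldots,\ell_n}$ (finite sum over multi-indices, variables in this fixed order, coefficients in $\mathbb{H}$ on the right). $\mathbb{H}[q_1,\ldots,q_n]$ is the set of these; it is a (non-commutative) ring under $+$ and the $*$-product, the biadditive extension of $(q_1^{\ell_1}\cdots q_n^{\ell_n}a)*(q_1^{m_1}\cdots q_n^{m_n}b)=q_1^{\ell_1+m_1}\cdots q_n^{\ell_n+m_n}ab$. Right ideals are taken with respect to this ring structure. For a right ideal $I$, $\mathcal{V}(I)\subseteq\mathbb{H}^n$ is the set of common zeros (under pointwise evaluation) of all $P\in I$. Let $\mathbb{S}=\{q\in\mathbb{H}: q^2=-1\}$ and $\mathbb{C}_J=\mathbb{R}+\mathbb{R}J$ for $J\in\mathbb{S}$. Then $\mathcal{V}_c(I)=\mathcal{V}(I)\cap\bigcup_{J\in\mathbb{S}}(\mathbb{C}_J)^n$, i.e. the points of $\mathcal{V}(I)$ with pairwise commuting components. For $Z\subseteq\mathbb{H}^n$, $\mathcal{J}(Z)=\{\sum_{k=1}^N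 P_k*Q_k : P_k,Q_k\in\mathbb{H}[q_1,\ldots,q_n],\ P_k|_Z\equiv 0\}$ is the right ideal generated by the slice regular polynomials vanishing on $Z$; in particular $\mathcal{J}(\varnothing)=\mathbb{H}[q_1,\ldots,q_n]$. *)

theory Defs
  imports
    "HOL-Analysis.Finite_Cartesian_Product"
    "HOL-Library.Poly_Mapping"
    "HOL-Computational_Algebra.Polynomial"
begin

datatype quat = Quat (qRe: real) (qI: real) (qJ: real) (qK: real)

lemma quat_eq_iff:
  "x = y \<longleftrightarrow> qRe x = qRe y \<and> qI x = qI y \<and> qJ x = qJ y \<and> qK x = qK y"
  by (cases x; cases y) simp

instantiation quat :: ab_group_add
begin

definition "0 = Quat 0 0 0 0"
definition "x + y = Quat (qRe x + qRe y) (qI x + qI y) (qJ x + qJ y) (qK x + qK y)"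
definition "- x = Quat (- qRe x) (- qI x) (- qJ x) (- qK x)"
definition "x - y = Quat (qRe x - qRe y) (qI x - qI y) (qJ x - qJ y) (qK x - qK y)"

instance
  by standard (simp_all add: quat_eq_iff zero_quat_def plus_quat_def uminus_quat_def minus_quat_def)

end

lemma quat_add_sel [simp]:
  "qRe 0 = 0" "qI 0 = 0" "qJ 0 = 0" "qK 0 = 0"
  "qRe (x + y) = qRe x + qRe y" "qI (x + y) = qI x + qI y"
  "qJ (x + y) = qJ x + qJ y" "qK (x + y) = qK x + qK y"
  "qRe (- x) = - qRe x" "qI (- x) = - qI x" "qJ (- x) = - qJ x" "qK (- x) = - qK x"
  "qRe (x - y) = qRe x - qRe y" "qI (x - y) = qI x - qI y"
  "qJ (x - y) = qJ x - qJ y" "qK (x - y) = qK x - qK y"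
  by (simp_all add: zero_quat_def plus_quat_def uminus_quat_def minus_quat_def)

instantiation quat :: "{real_algebra_1, division_ring}"
begin

definition "1 = Quat 1 0 0 0"
definition "x * y = Quat
  (qRe x * qRe y - qI x * qI y - qJ x * qJ y - qK x * qK y)
  (qRe x * qI y + qI x * qRe y + qJ x * qK y - qK x * qJ y)
  (qRe x * qJ y - qI x * qK y + qJ x * qRe y + qK x * qI y)
  (qRe x * qK y + qI x * qJ y - qJ x * qI y + qK x * qRe y)"
definition "r *\<^sub>R x = Quat (r * qRe x) (r * qI x) (r * qJ x) (r * qK x)"
definition "inverse x =
  (let N = (qRe x)\<^sup>2 + (qI x)\<^sup>2 + (qJ x)\<^sup>2 + (qK x)\<^sup>2
   in Quat (qRe x / N) (- qI x / N) (- qJ x / N) (- qK x / N))"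
definition "x div y = x * inverse y" for x y :: quat

instance
proof
  fix x :: quat
  assume "x \<noteq> 0"
  define N where "N = (qRe x)\<^sup>2 + (qI x)\<^sup>2 + (qJ x)\<^sup>2 + (qK x)\<^sup>2"
  have "N \<noteq> 0"
    using \<open>x \<noteq> 0\<close> unfolding N_def quat_eq_iff
    by (auto simp: add_nonneg_eq_0_iff)
  then show "inverse x * x = 1" "x * inverse x = 1"
    unfolding quat_eq_iff inverse_quat_def Let_def one_quat_def times_quat_def N_def[symmetric]
    by (simp_all add: divide_simps) (simp_all add: N_def power2_eq_square)
qed (simp_all add: quat_eq_iff one_quat_def times_quat_def scaleR_quat_def inverse_quat_def
       divide_quat_def algebra_simps)

end

(* Slice regular polynomials, given by their coefficients: q_1^{l_1} ... q_n^{l_n} a corresponds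
   to single l a.  The multiplication of the library type is the convolution
   single l a * single m b = single (l + m) (a * b), i.e. the *-product.
   The variables are indexed by a finite linearly ordered type, which fixes their order in
   the monomials.  By spoly_eval_inject, a polynomial may be identified with the
   function it induces. *)
type_synonym 'n spoly = "('n \<Rightarrow>\<^sub>0 nat) \<Rightarrow>\<^sub>0 quat"

definition monom_eval :: "('n::{finite,linorder} \<Rightarrow>\<^sub>0 nat) \<Rightarrow> (quat, 'n) vec \<Rightarrow> quat" where
  "monom_eval l q = prod_list (map (\<lambda>i. (q $ i) ^ Poly_Mapping.lookup l i) (sorted_list_of_set UNIV))"

definition spoly_eval :: "'n::{finite,linorder} spoly \<Rightarrow> (quat, 'n) vec \<Rightarrow> quat" where
  "spoly_eval P q = (\<Sum>l\<in>Poly_Mapping.keys P. monom_eval l q * Poly_Mapping.lookup P l)"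

definition right_ideal :: "'a::ring_1 set \<Rightarrow> bool" where
  "right_ideal I \<longleftrightarrow>
     0 \<in> I \<and> (\<forall>x\<in>I. \<forall>y\<in>I. x + y \<in> I) \<and> (\<forall>x\<in>I. \<forall>r. x * r \<in> I)"

definition zero_set :: "'n::{finite,linorder} spoly set \<Rightarrow> (quat, 'n) vec set" where
  "zero_set I = {q. \<forall>P\<in>I. spoly_eval P q = 0}"

definition vanishing :: "(quat, 'n::{finite,linorder}) vec set \<Rightarrow> 'n spoly set" where
  "vanishing Z = {P. \<forall>q\<in>Z. spoly_eval P q = 0}"

definition imag_units :: "quat set" where
  "imag_units = {J. J\<^sup>2 = -1}"

definition slice :: "quat \<Rightarrow> quat set" where
  "slice J = {of_real x + of_real y * J | x y. True}"

definition zero_set_c :: "'n::{finite,linorder} spoly set \<Rightarrow> (quat, 'n) vec set" where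
  "zero_set_c I = zero_set I \<inter> (\<Union>J\<in>imag_units. {q. \<forall>i. q $ i \<in> slice J})"

definition vanishing_ideal :: "(quat, 'n::{finite,linorder}) vec set \<Rightarrow> 'n spoly set" where
  "vanishing_ideal Z =
     {\<Sum>k<N. P k * Q k | (N :: nat) P Q. \<forall>k<N. P k \<in> vanishing Z}"

lemma right_ideal_vanishing_ideal: "right_ideal (vanishing_ideal Z)"
  unfolding right_ideal_def
proof (intro conjI ballI allI)
  show "0 \<in> vanishing_ideal Z"
    unfolding vanishing_ideal_def by (auto intro!: exI[of _ "0::nat"])
next
  fix x y assume "x \<in> vanishing_ideal Z" "y \<in> vanishing_ideal Z"
  then obtain N M :: nat and P Q P' Q' where
    x: "x = (\<Sum>k<N. P k * Q k)" "\<forall>k<N. P k \<in> vanishing Z" and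
    y: "y = (\<Sum>k<M. P' k * Q' k)" "\<forall>k<M. P' k \<in> vanishing Z"
    unfolding vanishing_ideal_def mem_Collect_eq by (elim exE conjE) (rule that)
  define R S where "R k = (if k < N then P k else P' (k - N))"
    and "S k = (if k < N then Q k else Q' (k - N))" for k
  have "(\<Sum>k<N + m. R k * S k) = (\<Sum>k<N. P k * Q k) + (\<Sum>k<m. P' k * Q' k)" for m
    by (induction m) (simp_all add: R_def S_def add.assoc)
  then have "x + y = (\<Sum>k<N + M. R k * S k)"
    by (simp add: x y)
  moreover have "\<forall>k<N + M. R k \<in> vanishing Z"
    using x y by (auto simp: R_def)
  ultimately show "x + y \<in> vanishing_ideal Z"
    unfolding vanishing_ideal_def by blast
next
  fix x r assume "x \<in> vanishing_ideal Z"
  then obtain N P Q where x: "x = (\<Sum>k<N::nat. P k * Q k)" "\<forall>k<N. P k \<in> vanishing Z"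
    unfolding vanishing_ideal_def by blast
  then have "x * r = (\<Sum>k<N. P k * (Q k * r))"
    by (simp add: sum_distrib_right mult.assoc)
  with x show "x * r \<in> vanishing_ideal Z"
    unfolding vanishing_ideal_def by (intro CollectI exI[of _ N] exI[of _ P] exI) auto
qed

lemma horner_sum_inject:
  fixes f g :: "'a \<Rightarrow> nat"
  assumes "horner_sum f B xs = horner_sum g B xs"
    and "\<forall>x\<in>set xs. f x < B \<and> g x < B"
  shows "\<forall>x\<in>set xs. f x = g x"
  using assms
proof (induction xs)
  case (Cons x xs)
  have lt: "f x < B" "g x < B" "\<forall>x\<in>set xs. f x < B \<and> g x < B"
    using Cons.prems(2) unfolding list.set ball_simps by blast+
  have eq: "f x + B * horner_sum f B xs = g x + B * horner_sum g B xs"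
    using Cons.prems(1) by (simp only: horner_sum_simps)
  have "f x = (f x + B * horner_sum f B xs) mod B" using lt(1) by simp
  also have "\<dots> = (g x + B * horner_sum g B xs) mod B" by (simp only: eq)
  also have "\<dots> = g x" using lt(2) by simp
  finally have head: "f x = g x" .
  with eq have "B * horner_sum f B xs = B * horner_sum g B xs" by linarith
  then have "horner_sum f B xs = horner_sum g B xs"
    using lt(1) by (metis mult_cancel1 not_less_zero)
  then have "\<forall>x\<in>set xs. f x = g x" using lt(3) by (rule Cons.IH)
  with head show ?case by (simp only: list.set ball_simps simp_thms)
qed simp

lemma ex_horner_weights:
  assumes "distinct xs"
  shows "\<exists>w :: 'a \<Rightarrow> nat. \<forall>f t. prod_list (map (\<lambda>i. (t ^ w i) ^ f i) xs) =
    (t :: real) ^ horner_sum f B xs"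
  using assms
proof (induction xs)
  case (Cons x xs)
  then obtain w where w: "\<And>f t. prod_list (map (\<lambda>i. (t ^ w i) ^ f i) xs) =
    (t :: real) ^ horner_sum f B xs" by auto
  let ?w = "\<lambda>i. if i = x then 1 else B * w i"
  have "prod_list (map (\<lambda>i. (t ^ ?w i) ^ f i) (x # xs)) = t ^ horner_sum f B (x # xs)"
    for f and t :: real
  proof -
    have eq: "map (\<lambda>i. (t ^ ?w i) ^ f i) xs = map (\<lambda>i. ((t ^ B) ^ w i) ^ f i) xs"
      using Cons.prems by (auto simp: power_mult)
    have "prod_list (map (\<lambda>i. (t ^ ?w i) ^ f i) xs) = (t ^ B) ^ horner_sum f B xs"
      unfolding eq by (rule w)
    then show ?thesis by (simp add: power_add power_mult)
  qed
  then show ?case by (intro exI[of _ ?w]) blast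
qed simp

lemma spoly_eval_eq_0:
  fixes P :: "'n::{finite,linorder} spoly"
  assumes "\<And>q. spoly_eval P q = 0"
  shows "P = 0"
proof (rule ccontr)
  assume "P \<noteq> 0"
  then obtain m where m: "m \<in> Poly_Mapping.keys P"
    by (metis all_not_in_conv keys_eq_empty)
  let ?xs = "sorted_list_of_set (UNIV :: 'n set)"
  define B where "B = Suc (Max ((\<lambda>(l, i). Poly_Mapping.lookup l i) ` (Poly_Mapping.keys P \<times> UNIV)))"
  have B: "Poly_Mapping.lookup l i < B" if "l \<in> Poly_Mapping.keys P" for l i
    unfolding B_def using that
    by (intro le_imp_less_Suc Max_ge) (auto intro!: image_eqI[of _ _ "(l, i)"])
  define e where "e l = horner_sum (Poly_Mapping.lookup l) B ?xs" for l :: "'n \<Rightarrow>\<^sub>0 nat"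
  have inj: "l = l'" if "l \<in> Poly_Mapping.keys P" "l' \<in> Poly_Mapping.keys P" "e l = e l'" for l l'
    using horner_sum_inject[of "Poly_Mapping.lookup l" B ?xs "Poly_Mapping.lookup l'"] that B
    by (auto simp: e_def intro: poly_mapping_eqI)
  obtain w where w: "\<And>f t. prod_list (map (\<lambda>i. (t ^ w i) ^ f i) ?xs) =
    (t :: real) ^ horner_sum f B ?xs"
    using ex_horner_weights[of ?xs B] by auto
  have of_real_list: "prod_list (map (\<lambda>i. of_real (h i) :: quat) xs) = of_real (prod_list (map h xs))"
    for h and xs :: "'n list"
    by (induction xs) simp_all
  have ev: "spoly_eval P (\<chi> i. of_real (t ^ w i)) = (\<Sum>l\<in>Poly_Mapping.keys P. t ^ e l *\<^sub>R Poly_Mapping.lookup P l)" for t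
  proof -
    have "monom_eval l (\<chi> i. of_real (t ^ w i)) = of_real (t ^ e l)" for l :: "'n \<Rightarrow>\<^sub>0 nat"
      using of_real_list[of "\<lambda>i. (t ^ w i) ^ Poly_Mapping.lookup l i" ?xs]
      by (simp add: monom_eval_def e_def w)
    then show ?thesis
      by (simp add: spoly_eval_def scaleR_conv_of_real)
  qed
  have zero: "\<pi> (Poly_Mapping.lookup P m) = 0"
    if lin: "\<And>x y. \<pi> (x + y) = \<pi> x + \<pi> y" "\<And>r x. \<pi> (r *\<^sub>R x) = r * \<pi> x" "\<pi> 0 = 0"
    for \<pi> :: "quat \<Rightarrow> real"
  proof -
    have sum: "\<pi> (\<Sum>l\<in>A. h l) = (\<Sum>l\<in>A. \<pi> (h l))" for A and h :: "('n \<Rightarrow>\<^sub>0 nat) \<Rightarrow> quat"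
      by (induction A rule: infinite_finite_induct) (simp_all add: lin)
    define p where "p = (\<Sum>l\<in>Poly_Mapping.keys P. monom (\<pi> (Poly_Mapping.lookup P l)) (e l))"
    have "poly p t = 0" for t
    proof -
      have "poly p t = \<pi> (spoly_eval P (\<chi> i. of_real (t ^ w i)))"
        unfolding ev p_def by (simp add: sum lin poly_sum poly_monom mult.commute)
      then show ?thesis using assms lin by simp
    qed
    then have "p = 0" by (simp add: poly_all_0_iff_0[symmetric])
    moreover have "coeff p (e m) = (\<Sum>l\<in>Poly_Mapping.keys P. if l = m then \<pi> (Poly_Mapping.lookup P l) else 0)"
      unfolding p_def coeff_sum coeff_monom using inj m by (intro sum.cong) auto
    ultimately show ?thesis using m by simp
  qed
  have "Poly_Mapping.lookup P m = 0"
    unfolding quat_eq_iff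
    using zero[of qRe] zero[of qI] zero[of qJ] zero[of qK]
    by (simp add: scaleR_quat_def)
  with m show False by (simp only: in_keys_iff simp_thms)
qed

lemma spoly_eval_superset:
  assumes "finite A" "Poly_Mapping.keys P \<subseteq> A"
  shows "spoly_eval P q = (\<Sum>l\<in>A. monom_eval l q * Poly_Mapping.lookup P l)"
  unfolding spoly_eval_def using assms
  by (rule sum.mono_neutral_left) (simp_all add: in_keys_iff)

lemma spoly_eval_diff: "spoly_eval (P - Q) q = spoly_eval P q - spoly_eval Q q"
proof -
  let ?A = "Poly_Mapping.keys P \<union> Poly_Mapping.keys Q"
  have "Poly_Mapping.keys (P - Q) \<subseteq> ?A"
    by (fact keys_diff)
  then have "spoly_eval (P - Q) q =
      (\<Sum>l\<in>?A. monom_eval l q * Poly_Mapping.lookup (P - Q) l)"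
    by (intro spoly_eval_superset) simp_all
  moreover have "spoly_eval P q = (\<Sum>l\<in>?A. monom_eval l q * Poly_Mapping.lookup P l)"
    and "spoly_eval Q q = (\<Sum>l\<in>?A. monom_eval l q * Poly_Mapping.lookup Q l)"
    by (intro spoly_eval_superset; simp)+
  ultimately show ?thesis
    by (simp only: lookup_minus right_diff_distrib sum_subtractf)
qed

lemma spoly_eval_inject: "spoly_eval P = spoly_eval Q \<longleftrightarrow> P = Q"
proof
  assume "spoly_eval P = spoly_eval Q"
  then have "P - Q = 0"
    by (intro spoly_eval_eq_0) (simp add: spoly_eval_diff)
  then show "P = Q" by simp
qed simp

end

theory Submission
  imports Defs
begin

text \<open>
  Let \<open>p\<close> be a common zero of \<open>I\<close> and \<open>J\<close> the imaginary unit of its last non-real coordinate. For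
  imaginary units \<open>K\<close> and real \<open>a\<close>, \<open>b\<close> one has
  \<open>(a + b K) D = D\<^sub>1 (a + b J) + D\<^sub>2 (a - b J)\<close> with \<open>D\<^sub>1 = (D - K D J) / 2\<close> and
  \<open>D\<^sub>2 = (D + K D J) / 2\<close>. Moving the coordinates into \<open>\<complex>\<^sub>J\<close> from right to left, this writes
  evaluation at \<open>p\<close> as a combination \<open>\<Sum>\<^sub>q D\<^sub>q F(q)\<close> of evaluations at points \<open>q \<in> \<complex>\<^sub>J\<^sup>n\<close>, no two of
  which are equal or conjugate. Real, hence central, linear polynomials separate these points, so
  each summand vanishes on \<open>I\<close> separately: either \<open>D\<^sub>q = 0\<close> or \<open>q \<in> \<V>\<^sub>c(I)\<close>. At the commuting points
  \<open>q \<in> \<V>\<^sub>c(I)\<close>, evaluation of \<open>P * Q\<close> vanishes along with that of \<open>P\<close>.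
\<close>

section \<open>Imaginary units and slices\<close>

lemma quat_of_real_sel [simp]:
  "qRe (of_real r) = r" "qI (of_real r) = 0" "qJ (of_real r) = 0" "qK (of_real r) = 0"
  by (simp_all add: of_real_def scaleR_quat_def one_quat_def)

lemma imag_unitsD: "J \<in> imag_units \<Longrightarrow> J * J = -1"
  by (simp add: imag_units_def power2_eq_square)

lemma quat_of_real_commute: "of_real r * (x :: quat) = x * of_real r"
  by (simp add: quat_eq_iff times_quat_def)

lemma quat_imag_unit_decomp:
  fixes p :: quat
  obtains x y J where "J \<in> imag_units" "p = of_real x + of_real y * J"
proof -
  define N where "N = (qI p)\<^sup>2 + (qJ p)\<^sup>2 + (qK p)\<^sup>2"
  show thesis
  proof (cases "N = 0")
    case True
    then have "qI p = 0" "qJ p = 0" "qK p = 0"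
      by (auto simp: N_def add_nonneg_eq_0_iff)
    then show thesis
      by (intro that[of "Quat 0 1 0 0" "qRe p" 0])
        (simp_all add: imag_units_def power2_eq_square quat_eq_iff times_quat_def one_quat_def)
  next
    case False
    define y where "y = sqrt N"
    have "N \<ge> 0" by (simp add: N_def)
    then have y: "y \<noteq> 0" "y * y = N" using False by (simp_all add: y_def)
    have "qI p * qI p + qJ p * qJ p + qK p * qK p = y * y"
      using y by (simp add: N_def power2_eq_square)
    then show thesis using y(1)
      by (intro that[of "Quat 0 (qI p / y) (qJ p / y) (qK p / y)" "qRe p" y])
        (simp_all add: imag_units_def power2_eq_square quat_eq_iff times_quat_def one_quat_def
          field_simps)
  qed
qed

lemma of_real_in_slice: "of_real r \<in> slice J"
proof -
  have "of_real r = of_real r + of_real 0 * J" by simp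
  then show ?thesis unfolding slice_def by blast
qed

lemma slice_commute:
  assumes "a \<in> slice J" "b \<in> slice J"
  shows "a * b = b * a"
  using assms by (auto simp: slice_def quat_eq_iff times_quat_def algebra_simps)

text \<open>Only \<open>J * J = -1\<close> enters the recursion for the components, so the same real
  \<open>a\<close>, \<open>b\<close> serve all units. This extends identities linear in
  \<open>of_real a + of_real b * J\<close> to powers.\<close>

lemma imag_unit_power:
  "\<exists>a b. \<forall>J\<in>imag_units. (of_real x + of_real y * J) ^ k = of_real a + of_real b * J"
proof (induction k)
  case 0
  show ?case by (intro exI[of _ 1] exI[of _ 0]) simp
next
  case (Suc k)
  then obtain a b where ab:
    "\<And>J. J \<in> imag_units \<Longrightarrow> (of_real x + of_real y * J) ^ k = of_real a + of_real b * J"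
    by blast
  have "(of_real x + of_real y * J) ^ Suc k = of_real (x * a - y * b) + of_real (x * b + y * a) * J"
    if J: "J \<in> imag_units" for J
  proof -
    have "of_real y * J * (of_real b * J) = of_real (y * b) * (J * J)"
      by (metis mult.assoc of_real_mult quat_of_real_commute)
    moreover have "of_real y * J * of_real a = of_real (y * a) * J"
      by (metis mult.assoc of_real_mult quat_of_real_commute)
    ultimately show ?thesis
      by (simp only: power_Suc ab[OF J] imag_unitsD[OF J] distrib_left distrib_right
          of_real_add of_real_diff)
        (simp add: distrib_right mult.assoc)
  qed
  then show ?case by blast
qed

text \<open>With D1, D2 the coefficients on the right, D1 + D2 = D and (D1 - D2) J = - K D J J = K
  D.\<close>

lemma imag_unit_change:
  fixes D J K :: quat
  assumes "J \<in> imag_units"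
  shows "(of_real a + of_real b * K) * D =
    of_real (1/2) * (D - K * D * J) * (of_real a + of_real b * J) +
    of_real (1/2) * (D + K * D * J) * (of_real a - of_real b * J)"
proof -
  have *: "K * D * J * (of_real b * J) = - (of_real b * (K * D))"
    by (metis assms imag_unitsD mult.assoc mult_minus1_right quat_of_real_commute)
  have h: "of_real (1/2) * (X - Y) * (A + B) + of_real (1/2) * (X + Y) * (A - B) = X * A - Y * B"
    for X Y A B :: quat
    by (simp add: quat_eq_iff times_quat_def) (simp add: field_simps)
  show ?thesis
    unfolding h * by (simp add: distrib_right mult.assoc quat_of_real_commute[of _ D])
qed

section \<open>Linear functionals on slice regular polynomials\<close>

text \<open>Right-linear functionals with arbitrary values on monomials: products with a quaternion
  inserted between the variables need not be point evaluations.\<close>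

definition lin_eval :: "('a \<Rightarrow> quat) \<Rightarrow> ('a \<Rightarrow>\<^sub>0 quat) \<Rightarrow> quat" where
  "lin_eval \<phi> F = (\<Sum>l\<in>Poly_Mapping.keys F. \<phi> l * Poly_Mapping.lookup F l)"

lemma lin_eval_superset:
  assumes "finite A" "Poly_Mapping.keys F \<subseteq> A"
  shows "lin_eval \<phi> F = (\<Sum>l\<in>A. \<phi> l * Poly_Mapping.lookup F l)"
  unfolding lin_eval_def using assms
  by (rule sum.mono_neutral_left) (simp_all add: in_keys_iff)

lemma lin_eval_zero [simp]: "lin_eval \<phi> 0 = 0"
  by (simp add: lin_eval_def)

lemma lin_eval_single [simp]: "lin_eval \<phi> (Poly_Mapping.single l a) = \<phi> l * a"
  by (simp add: lin_eval_def)

lemma lin_eval_add: "lin_eval \<phi> (F + G) = lin_eval \<phi> F + lin_eval \<phi> G"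
proof -
  let ?A = "Poly_Mapping.keys F \<union> Poly_Mapping.keys G"
  have "lin_eval \<phi> H = (\<Sum>l\<in>?A. \<phi> l * Poly_Mapping.lookup H l)"
    if "Poly_Mapping.keys H \<subseteq> ?A" for H
    using that by (intro lin_eval_superset) simp_all
  from this[of F] this[of G] this[of "F + G"] show ?thesis
    using keys_add[of F G] by (simp add: lookup_add distrib_left sum.distrib)
qed

lemma lin_eval_sum: "lin_eval \<phi> (\<Sum>k\<in>A. f k) = (\<Sum>k\<in>A. lin_eval \<phi> (f k))"
  by (induction A rule: infinite_finite_induct) (simp_all add: lin_eval_add)

lemma lin_eval_fun_add: "lin_eval (\<lambda>l. \<phi> l + \<psi> l) F = lin_eval \<phi> F + lin_eval \<psi> F"
  by (simp add: lin_eval_def distrib_right sum.distrib)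

lemma lin_eval_fun_uminus: "lin_eval (\<lambda>l. - \<phi> l) F = - lin_eval \<phi> F"
  by (simp add: lin_eval_def sum_negf)

lemma lin_eval_fun_mult: "lin_eval (\<lambda>l. c * \<phi> l) F = c * lin_eval \<phi> F"
  by (simp add: lin_eval_def sum_distrib_left mult.assoc)

lemma poly_mapping_sum_single:
  "F = (\<Sum>l\<in>Poly_Mapping.keys F. Poly_Mapping.single l (Poly_Mapping.lookup F l))"
  by (rule poly_mapping_eqI) (simp add: lookup_sum lookup_single when_def in_keys_iff)

lemma lin_eval_mult_single:
  "lin_eval \<phi> (F * Poly_Mapping.single m b) = lin_eval (\<lambda>l. \<phi> (l + m)) F * b"
proof -
  have "F * Poly_Mapping.single m b =
      (\<Sum>l\<in>Poly_Mapping.keys F. Poly_Mapping.single (l + m) (Poly_Mapping.lookup F l * b))"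
    by (subst poly_mapping_sum_single[of F]) (simp add: sum_distrib_right mult_single)
  then show ?thesis
    by (simp add: lin_eval_sum) (simp add: lin_eval_def sum_distrib_right mult.assoc)
qed

lemma lin_eval_mult:
  "lin_eval \<phi> (F * G) =
    (\<Sum>m\<in>Poly_Mapping.keys G. lin_eval (\<lambda>l. \<phi> (l + m)) F * Poly_Mapping.lookup G m)"
  by (subst poly_mapping_sum_single[of G])
    (simp add: sum_distrib_left lin_eval_sum lin_eval_mult_single)

section \<open>Monomials over part of the variables\<close>

definition mono_prod :: "('n \<Rightarrow> quat) \<Rightarrow> 'n list \<Rightarrow> ('n \<Rightarrow>\<^sub>0 nat) \<Rightarrow> quat" where
  "mono_prod p xs l = prod_list (map (\<lambda>i. p i ^ Poly_Mapping.lookup l i) xs)"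

lemma mono_prod_simps [simp]:
  "mono_prod p [] l = 1"
  "mono_prod p (x # xs) l = p x ^ Poly_Mapping.lookup l x * mono_prod p xs l"
  "mono_prod p (xs @ ys) l = mono_prod p xs l * mono_prod p ys l"
  by (simp_all add: mono_prod_def)

lemma mono_prod_cong:
  "(\<And>i. i \<in> set xs \<Longrightarrow> p i = q i) \<Longrightarrow> mono_prod p xs l = mono_prod q xs l"
  unfolding mono_prod_def by (metis (mono_tags, lifting) map_cong)

lemma spoly_eval_eq_lin_eval:
  "spoly_eval F q = lin_eval (mono_prod (($) q) (sorted_list_of_set UNIV)) F"
  by (simp add: spoly_eval_def lin_eval_def mono_prod_def monom_eval_def)

lemma slice_commute_mono_prod:
  assumes "a \<in> slice J" "\<And>i. i \<in> set xs \<Longrightarrow> p i \<in> slice J"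
  shows "a * mono_prod p xs l = mono_prod p xs l * a"
  using assms(2)
proof (induction xs)
  case (Cons x xs)
  have "a * p x = p x * a"
    using Cons.prems assms(1) by (intro slice_commute[of _ J]) auto
  then have "a * p x ^ k = p x ^ k * a" for k
    by (simp add: power_commuting_commutes)
  with Cons show ?case
    by (metis list.set_intros(2) mono_prod_simps(2) mult.assoc)
qed simp

text \<open>All factors commute inside one slice. The \<open>m\<close> part is put on the left so
  that it leaves \<open>lin_eval\<close> as a left factor.\<close>

lemma mono_prod_add:
  assumes "\<And>i. i \<in> set xs \<Longrightarrow> p i \<in> slice J"
  shows "mono_prod p xs (l + m) = mono_prod p xs m * mono_prod p xs l"
  using assms
proof (induction xs)
  case (Cons x xs)
  have c: "p x ^ k * mono_prod p xs m = mono_prod p xs m * p x ^ k" for k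
    using Cons.prems slice_commute_mono_prod[of "p x" J xs p m]
    by (simp add: power_commuting_commutes)
  have "mono_prod p (x # xs) (l + m) = p x ^ Poly_Mapping.lookup m x *
      (p x ^ Poly_Mapping.lookup l x * mono_prod p xs m) * mono_prod p xs l"
    using Cons
    by (simp add: lookup_add add.commute[of "Poly_Mapping.lookup l x"] power_add mult.assoc)
  then show ?case unfolding c by (simp add: mult.assoc)
qed simp

lemma mono_prod_single:
  assumes "distinct xs"
  shows "mono_prod p xs (Poly_Mapping.single i 1) = (if i \<in> set xs then p i else 1)"
  using assms by (induction xs) (auto simp: lookup_single when_def)

lemma mono_prod_add_single:
  "i \<notin> set xs \<Longrightarrow> mono_prod p xs (l + Poly_Mapping.single i k) = mono_prod p xs l"
  by (induction xs) (auto simp: lookup_add lookup_single)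

section \<open>Partially commuting evaluation\<close>

text \<open>The coordinates in \<open>ys\<close> keep their original values, those in
  \<open>zs\<close> have already been moved into the common slice, and \<open>D\<close> collects the
  coefficients produced by these moves.\<close>

definition split_eval ::
    "('n \<Rightarrow> quat) \<Rightarrow> 'n list \<Rightarrow> quat \<Rightarrow> 'n list \<Rightarrow> 'n spoly \<Rightarrow> quat" where
  "split_eval p ys D zs = lin_eval (\<lambda>l. mono_prod p ys l * D * mono_prod p zs l)"

lemma split_eval_add_mid:
  "split_eval p ys (D + E) zs F = split_eval p ys D zs F + split_eval p ys E zs F"
  by (simp add: split_eval_def distrib_left distrib_right lin_eval_fun_add)

lemma split_eval_uminus_mid: "split_eval p ys (- D) zs F = - split_eval p ys D zs F"
  by (simp add: split_eval_def lin_eval_fun_uminus)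

lemma split_eval_mult_of_real:
  "split_eval p ys D zs (F * Poly_Mapping.single 0 (of_real a)) =
    split_eval p ys (D * of_real a) zs F"
proof -
  have "mono_prod p ys l * (D * of_real a) * mono_prod p zs l =
      of_real a * (mono_prod p ys l * D * mono_prod p zs l)" for l
    by (metis mult.assoc quat_of_real_commute)
  then show ?thesis
    by (simp add: split_eval_def lin_eval_mult_single lin_eval_fun_mult
        flip: quat_of_real_commute)
qed

text \<open>The extra factor \<open>p i\<close> commutes with the product over \<open>zs\<close>, so
  it can be moved left until it meets \<open>D\<close>; the product over \<open>ys\<close> does not
  involve the variable \<open>i\<close>.\<close>

lemma split_eval_mult_var:
  assumes "distinct zs" "i \<in> set zs" "i \<notin> set ys" "\<And>i. i \<in> set zs \<Longrightarrow> p i \<in> slice J"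
  shows "split_eval p ys D zs (F * Poly_Mapping.single (Poly_Mapping.single i 1) 1) =
    split_eval p ys (D * p i) zs F"
proof -
  have "mono_prod p zs (l + Poly_Mapping.single i 1) = p i * mono_prod p zs l" for l
    using mono_prod_add[of zs p J l "Poly_Mapping.single i 1"] assms mono_prod_single[OF assms(1)]
    by simp
  then show ?thesis
    using assms(3)
    by (simp add: split_eval_def lin_eval_mult_single mono_prod_add_single mult.assoc)
qed

text \<open>The polynomial a q_i + b q_m + c, written with products by constants so that the rules
  for variables and for real constants apply to each term.\<close>

definition real_lin :: "'n \<Rightarrow> real \<Rightarrow> 'n \<Rightarrow> real \<Rightarrow> real \<Rightarrow> 'n spoly" where
  "real_lin i a m b c =
    Poly_Mapping.single (Poly_Mapping.single i 1) 1 * Poly_Mapping.single 0 (of_real a) +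
    Poly_Mapping.single (Poly_Mapping.single m 1) 1 * Poly_Mapping.single 0 (of_real b) +
    Poly_Mapping.single 0 (of_real c)"

lemma split_eval_mult_real_lin:
  assumes "distinct zs" "{i, m} \<subseteq> set zs" "{i, m} \<inter> set ys = {}"
    "\<And>i. i \<in> set zs \<Longrightarrow> p i \<in> slice J"
  shows "split_eval p ys D zs (F * real_lin i a m b c) =
    split_eval p ys (D * (of_real a * p i + of_real b * p m + of_real c)) zs F"
proof -
  have lin: "split_eval p ys D zs (G + H) = split_eval p ys D zs G + split_eval p ys D zs H" for G H
    by (simp add: split_eval_def lin_eval_add)
  have var: "split_eval p ys D zs
        (F * (Poly_Mapping.single (Poly_Mapping.single j 1) 1 * Poly_Mapping.single 0 (of_real r))) =
      split_eval p ys (D * (of_real r * p j)) zs F" if "j \<in> {i, m}" for j r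
    using assms that split_eval_mult_var[of zs j ys p J "D * of_real r" F]
    unfolding mult.assoc[of F, symmetric] split_eval_mult_of_real mult.assoc[of D, symmetric] by auto
  show ?thesis
    unfolding real_lin_def distrib_left lin split_eval_add_mid split_eval_mult_of_real
    using var[of i a] var[of m b] by simp
qed

text \<open>One move of a coordinate past \<open>D\<close>: \<open>imag_unit_change\<close> is
  applied to every power of \<open>p k\<close>, with coefficients that do not depend on the
  exponent.\<close>

lemma split_eval_change_unit:
  assumes J: "J \<in> imag_units" and K: "K \<in> imag_units" and pk: "p k = of_real x + of_real y * K"
    and k: "k \<notin> set ys" "k \<notin> set zs"
  shows "split_eval p (ys @ [k]) D zs F =
    split_eval (p(k := of_real x + of_real y * J)) ys (of_real (1/2) * (D - K * D * J)) (k # zs) F +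
    split_eval (p(k := of_real x + of_real (- y) * J)) ys (of_real (1/2) * (D + K * D * J))
      (k # zs) F"
proof -
  define D1 D2 where "D1 = of_real (1/2) * (D - K * D * J)" and "D2 = of_real (1/2) * (D + K * D * J)"
  define p1 p2 where "p1 = p(k := of_real x + of_real y * J)"
    and "p2 = p(k := of_real x + of_real (- y) * J)"
  \<comment> \<open>The value of \<open>p2\<close> at \<open>k\<close> is
    \<open>of_real x + of_real y * (- J)\<close>, so its powers have the same real components as
    those of \<open>p k\<close>.\<close>
  have mJ: "- J \<in> imag_units" using J by (simp add: imag_units_def)
  have pow: "p k ^ e * D = D1 * p1 k ^ e + D2 * p2 k ^ e" for e
  proof -
    obtain a b where ab: "\<And>J. J \<in> imag_units \<Longrightarrow>
        (of_real x + of_real y * J) ^ e = of_real a + of_real b * J"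
      using imag_unit_power by blast
    show ?thesis
      using ab[OF J] ab[OF K] ab[OF mJ] imag_unit_change[OF J, of a b K D]
      by (simp add: pk p1_def p2_def D1_def D2_def)
  qed
  have [simp]: "mono_prod p1 ys l = mono_prod p ys l" "mono_prod p2 ys l = mono_prod p ys l"
    "mono_prod p1 zs l = mono_prod p zs l" "mono_prod p2 zs l = mono_prod p zs l" for l
    using k by (auto intro!: mono_prod_cong simp: p1_def p2_def)
  have "mono_prod p (ys @ [k]) l * D * mono_prod p zs l =
      mono_prod p1 ys l * D1 * mono_prod p1 (k # zs) l +
      mono_prod p2 ys l * D2 * mono_prod p2 (k # zs) l" for l
  proof -
    have "p k ^ e * (D * X) = D1 * (p1 k ^ e * X) + D2 * (p2 k ^ e * X)" for e X
      by (metis distrib_right mult.assoc pow)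
    then show ?thesis by (simp add: mult.assoc distrib_left)
  qed
  then show ?thesis
    unfolding p1_def[symmetric] p2_def[symmetric] D1_def[symmetric] D2_def[symmetric]
    by (simp only: split_eval_def lin_eval_fun_add)
qed

section \<open>Reduction to commuting zeros\<close>

text \<open>At a point with coordinates in one slice, the term of \<open>Q\<close> with exponent m
  and coefficient b contributes q^m P(q) b to the value of \<open>P * Q\<close>, so P(q) = 0
  suffices.\<close>

lemma spoly_eval_vanishing_ideal_commuting:
  assumes F: "F \<in> vanishing_ideal Z" and q: "q \<in> Z" "\<And>i. q $ i \<in> slice J"
  shows "spoly_eval F q = 0"
proof -
  have "spoly_eval (P * Q) q = 0" if "spoly_eval P q = 0" for P Q
    using that
    by (simp add: spoly_eval_eq_lin_eval lin_eval_mult mono_prod_add[of _ _ J] q(2) lin_eval_fun_mult)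
  moreover obtain N P Q where "F = (\<Sum>k<N::nat. P k * Q k)" "\<forall>k<N. P k \<in> vanishing Z"
    using F unfolding vanishing_ideal_def by blast
  ultimately show ?thesis
    using q(1) by (simp add: spoly_eval_eq_lin_eval lin_eval_sum vanishing_def)
qed

text \<open>With no coordinates left to move, the functional is \<open>D\<close> times evaluation at
  a commuting point. In a skew field either \<open>D = 0\<close> or that point is a common zero of
  \<open>I\<close>.\<close>

lemma split_eval_commuting_vanishes:
  fixes I :: "('n::{finite,linorder}) spoly set"
  assumes J: "J \<in> imag_units" and p: "\<And>i. p i \<in> slice J"
    and I: "\<And>F. F \<in> I \<Longrightarrow> split_eval p [] D (sorted_list_of_set UNIV) F = 0"
    and F: "F \<in> vanishing_ideal (zero_set_c I)"
  shows "split_eval p [] D (sorted_list_of_set UNIV) F = 0"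
proof -
  define q where "q = (\<chi> i. p i)"
  have ev: "split_eval p [] D (sorted_list_of_set UNIV) G = D * spoly_eval G q" for G
  proof -
    have "mono_prod p xs = mono_prod (($) q) xs" for xs :: "'n list"
      by (auto intro!: mono_prod_cong simp: q_def)
    then show ?thesis by (simp add: split_eval_def lin_eval_fun_mult spoly_eval_eq_lin_eval)
  qed
  show ?thesis
  proof (cases "D = 0")
    case False
    then have "q \<in> zero_set_c I"
      using I J p by (auto simp: ev zero_set_c_def zero_set_def q_def)
    then have "spoly_eval F q = 0"
      using p by (intro spoly_eval_vanishing_ideal_commuting[OF F]) (auto simp: q_def)
    then show ?thesis by (simp add: ev)
  qed (simp add: split_eval_def lin_eval_def)
qed

text \<open>Induction moves the last entry of \<open>ys\<close> into \<open>zs\<close>. The non-real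
  coordinate \<open>p m\<close> stays fixed throughout; it distinguishes \<open>J\<close> from
  \<open>- J\<close> and so lets a real polynomial separate the two points created by a
  move.\<close>

lemma split_eval_vanishes:
  fixes I :: "('n::{finite,linorder}) spoly set"
  assumes I: "right_ideal I" and J: "J \<in> imag_units"
    and m: "m \<in> set zs" "p m = of_real u + of_real v * J" "v \<noteq> 0"
    and zs: "\<And>i. i \<in> set zs \<Longrightarrow> p i \<in> slice J"
    and ys: "ys @ zs = sorted_list_of_set UNIV"
    and van: "\<And>F. F \<in> I \<Longrightarrow> split_eval p ys D zs F = 0"
    and F: "F \<in> vanishing_ideal (zero_set_c I)"
  shows "split_eval p ys D zs F = 0"
  using m zs ys van
proof (induction ys arbitrary: zs p D rule: rev_induct)
  case Nil
  then have "set zs = UNIV" by simp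
  with Nil J F show ?case
    using split_eval_commuting_vanishes[of J p I D F] by auto
next
  case (snoc k ys)
  have "distinct ((ys @ [k]) @ zs)" unfolding snoc.prems(5) by simp
  then have dist: "distinct (k # zs)" "k \<notin> set ys" "k \<notin> set zs" "set ys \<inter> set (k # zs) = {}"
    by auto
  have km: "k \<noteq> m" using dist snoc.prems(1) by auto
  have list: "ys @ k # zs = sorted_list_of_set UNIV"
    using snoc.prems(5) by simp
  obtain x y K where K: "K \<in> imag_units" and pk: "p k = of_real x + of_real y * K"
    by (rule quat_imag_unit_decomp)
  show ?case
  proof (cases "y = 0")
    case True
    then have pk: "p k = of_real x" using pk by simp
    \<comment> \<open>A real coordinate is central: it passes \<open>D\<close> without changing
      \<open>p\<close> or \<open>D\<close>.\<close>
    have "p k ^ e * (D * X) = D * (p k ^ e * X)" for e X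
      unfolding pk by (metis mult.assoc of_real_power quat_of_real_commute)
    then have "mono_prod p (ys @ [k]) l * D * mono_prod p zs l =
        mono_prod p ys l * D * mono_prod p (k # zs) l" for l
      by (simp add: mult.assoc)
    then have eq: "split_eval p (ys @ [k]) D zs = split_eval p ys D (k # zs)"
      by (simp add: split_eval_def)
    have "p k \<in> slice J" unfolding pk by (rule of_real_in_slice)
    then show ?thesis
      unfolding eq using snoc.prems eq list
      by (intro snoc.IH) auto
  next
    case False
    define D1 D2 where "D1 = of_real (1/2) * (D - K * D * J)"
      and "D2 = of_real (1/2) * (D + K * D * J)"
    define p1 p2 where "p1 = p(k := of_real x + of_real y * J)"
      and "p2 = p(k := of_real x + of_real (- y) * J)"
    have split: "split_eval p (ys @ [k]) D zs G =
        split_eval p1 ys D1 (k # zs) G + split_eval p2 ys D2 (k # zs) G" for G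
      unfolding p1_def p2_def D1_def D2_def
      using split_eval_change_unit[where p = p and k = k, OF J K pk dist(2,3)] .
    have pm: "p1 m = of_real u + of_real v * J" "p2 m = of_real u + of_real v * J"
      using snoc.prems(2) km by (simp_all add: p1_def p2_def)
    have sl: "p1 i \<in> slice J" "p2 i \<in> slice J" if "i \<in> set (k # zs)" for i
    proof -
      have "of_real a + of_real b * J \<in> slice J" for a b by (auto simp: slice_def)
      from this[of x y] this[of x "- y"] show "p1 i \<in> slice J" "p2 i \<in> slice J"
        using that snoc.prems(4) unfolding p1_def p2_def fun_upd_apply by auto
    qed
    txt \<open>This real polynomial takes the value \<open>J\<close> at \<open>p1\<close> and \<open>0\<close> at \<open>p2\<close>.\<close>
    define R where "R = real_lin k (1 / (2 * y)) m (1 / (2 * v)) (- x / (2 * y) - u / (2 * v))"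
    have R: "split_eval p' ys E (k # zs) (G * R) =
        split_eval p' ys (E * (of_real (1 / (2 * y)) * p' k + of_real (1 / (2 * v)) * p' m +
          of_real (- x / (2 * y) - u / (2 * v)))) (k # zs) G"
      if "\<And>i. i \<in> set (k # zs) \<Longrightarrow> p' i \<in> slice J" for p' E G
      unfolding R_def using dist(2,4) snoc.prems(1)
      by (intro split_eval_mult_real_lin[OF dist(1) _ _ that]) auto
    have R1: "split_eval p1 ys E (k # zs) (G * R) = split_eval p1 ys (E * J) (k # zs) G" for E G
    proof -
      have "of_real (1 / (2 * y)) * p1 k + of_real (1 / (2 * v)) * p1 m +
          of_real (- x / (2 * y) - u / (2 * v)) = J"
        unfolding pm using False \<open>v \<noteq> 0\<close>
        by (simp add: p1_def quat_eq_iff times_quat_def field_simps)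
      then show ?thesis by (subst R) (simp_all only: sl(1))
    qed
    have R2: "split_eval p2 ys E (k # zs) (G * R) = 0" for E G
    proof -
      have "of_real (1 / (2 * y)) * p2 k + of_real (1 / (2 * v)) * p2 m +
          of_real (- x / (2 * y) - u / (2 * v)) = 0"
        unfolding pm using False \<open>v \<noteq> 0\<close>
        by (simp add: p2_def quat_eq_iff times_quat_def field_simps)
      then have "split_eval p2 ys E (k # zs) (G * R) = split_eval p2 ys (E * 0) (k # zs) G"
        by (subst R) (simp_all only: sl(2))
      then show ?thesis by (simp add: split_eval_def lin_eval_def)
    qed
    \<comment> \<open>Multiplying by \<open>R\<close> kills the \<open>p2\<close> summand and turns
      \<open>D1\<close> into \<open>D1 * J\<close>. A second factor \<open>R\<close> restores
      \<open>D1\<close> up to sign, and \<open>I\<close> is closed under both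
      multiplications.\<close>
    have van1: "split_eval p1 ys D1 (k # zs) G = 0" if "G \<in> I" for G
    proof -
      have "G * R * R \<in> I" using I that by (simp add: right_ideal_def)
      then have "0 = split_eval p1 ys D1 (k # zs) (G * R * R)"
        using snoc.prems(6) split[of "G * R * R"] R2[of D2 "G * R"] by simp
      also have "\<dots> = - split_eval p1 ys D1 (k # zs) G"
        by (simp add: R1 mult.assoc[of D1] imag_unitsD[OF J] split_eval_uminus_mid)
      finally show ?thesis by simp
    qed
    then have van2: "split_eval p2 ys D2 (k # zs) G = 0" if "G \<in> I" for G
      using that snoc.prems(6)[OF that] split by simp
    have "split_eval p1 ys D1 (k # zs) F = 0"
      using snoc.prems(1,3) pm(1) sl(1) list van1 by (intro snoc.IH) auto
    moreover have "split_eval p2 ys D2 (k # zs) F = 0"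
      using snoc.prems(1,3) pm(2) sl(2) list van2 by (intro snoc.IH) auto
    ultimately show ?thesis by (simp add: split)
  qed
qed

theorem theorem4p1:
  fixes I :: "('n::{finite,linorder}) spoly set"
  assumes "right_ideal I"
  shows "vanishing_ideal (zero_set_c I) \<subseteq> vanishing (zero_set I)"
proof (unfold vanishing_def, intro subsetI CollectI ballI)
  fix F q
  assume F: "F \<in> vanishing_ideal (zero_set_c I)" and "q \<in> zero_set I"
  then have van: "\<And>G. G \<in> I \<Longrightarrow> spoly_eval G q = 0" by (simp add: zero_set_def)
  let ?xs = "sorted_list_of_set (UNIV :: 'n set)"
  let ?real = "\<lambda>i. \<exists>r. q $ i = of_real r"
  \<comment> \<open>Before any move the inserted coefficient is 1, so the cut between
    \<open>ys\<close> and \<open>zs\<close> is arbitrary.\<close>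
  have ev: "spoly_eval G q = split_eval (($) q) ys 1 zs G" if "ys @ zs = ?xs" for G ys zs
    unfolding spoly_eval_eq_lin_eval split_eval_def that[symmetric] mono_prod_simps by simp
  have real: "q $ i \<in> slice J" if "?real i" for i J
    using that of_real_in_slice by auto
  show "spoly_eval F q = 0"
  proof (cases "\<forall>i. ?real i")
    case True
    obtain J where "J \<in> imag_units" using quat_imag_unit_decomp by blast
    then show ?thesis
      using split_eval_commuting_vanishes[of J "($) q" I 1 F] F van real True
      by (simp add: ev[of "[]"])
  next
    case False
    \<comment> \<open>Cutting at the last non-real coordinate leaves only real ones to its right, so
      \<open>m # zs\<close> lies in the slice of its unit from the start, and its imaginary part
      provides the nonzero \<open>v\<close>.\<close>
    then have "\<exists>i\<in>set ?xs. \<not> ?real i" by simp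
    then obtain ys m zs where xs: "?xs = ys @ m # zs" and m: "\<not> ?real m"
      and zs: "\<forall>i\<in>set zs. ?real i"
      using split_list_last_prop[of ?xs "\<lambda>i. \<not> ?real i"] by blast
    obtain x y J where J: "J \<in> imag_units" and qm: "q $ m = of_real x + of_real y * J"
      by (rule quat_imag_unit_decomp)
    have "y \<noteq> 0" using m qm by auto
    moreover have "q $ i \<in> slice J" if "i \<in> set (m # zs)" for i
      using that zs real qm by (auto simp: slice_def)
    ultimately show ?thesis
      using split_eval_vanishes[where p = "($) q" and m = m and zs = "m # zs" and ys = ys,
          OF assms J _ qm] F van
      by (simp add: ev[OF xs[symmetric]] xs)
  qed
qed

end
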